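(* Let $\mathbf K_{\mathbf{uy}},\mathbf K_{\mathbf u\boldsymbol\beta},\mathbf K_{\boldsymbol\beta\mathbf y},\mathbf K_{\boldsymbol\beta\mathbf u},\mathbf K_{\boldsymbol\beta\boldsymbol\beta}$ be (rational) transfer matrices of compatible dimensions such that $I-\mathbf K_{\boldsymbol\beta\boldsymbol\beta}$ is invertible, put $\mathbf Q=\mathbf K_{\mathbf u\boldsymbol\beta}(I-\mathbf K_{\boldsymbol\beta\boldsymbol\beta})^{-1}$, and assume $I-\mathbf Q\mathbf K_{\boldsymbol\beta\mathbf u}$ is invertible. Suppose the controller $\mathbf K$, with $\mathbf u=\mathbf K\mathbf y$, can be implemented by the realization $$\begin{bmatrix}\mathbf u\\ \boldsymbol\beta\end{bmatrix}=\begin{bmatrix}\mathbf K_{\mathbf{uy}}&0&\mathbf K_{\mathbf u\boldsymbol\beta}\\ \mathbf K_{\boldsymbol\beta\mathbf y}&\mathbf K_{\boldsymbol\beta\mathbf u}&\mathbf K_{\boldsymbol\beta\boldsymbol\beta}\end{bmatrix}\begin{bmatrix}\mathbf y\\ \mathbf u\\ \boldsymbol\beta\end{bmatrix}.$$ Then $$\mathbf K=(I-\mathbf Q\mathbf K_{\boldsymbol\beta\mathbf u})^{-1}(\mathbf K_{\mathbf{uy}}+\mathbf Q\mathbf K_{\boldsymbol\beta\mathbf y}).$$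
   Context: $\mathbf y$, $\mathbf u$, $\boldsymbol\beta$ are $z$-domain signals: the controller's input (measured output of the plant), the control signal, and an internal state of the controller. A controller $\mathbf K$ is a transfer matrix mapping $\mathbf y$ to $\mathbf u$. "$\mathbf K$ can be implemented by the realization" means that the two descriptions are equivalent: every triple $(\mathbf y,\mathbf u,\boldsymbol\beta)$ satisfying the realization equation has $\mathbf u=\mathbf K\mathbf y$. Invertibility is as matrices over the field of rational functions in $z$. *)

theory Defs
  imports
    "HOL-Analysis.Cartesian_Space"
    "HOL-Computational_Algebra.Fraction_Field"
    "HOL-Computational_Algebra.Polynomial"
begin

text \<open>
  Rational functions in the variable \<open>z\<close>; the coefficient field is left arbitrary
  (real or complex in control applications).
\<close>

type_synonym 'a ratfun = "'a poly fract"

text \<open>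
  The two block rows of
  \<open>[u; \<beta>] = [Kuy, 0, Kub; Kby, Kbu, Kbb] [y; u; \<beta>]\<close>, with \<open>b\<close> for \<open>\<beta>\<close>.
\<close>

definition realization ::
  "('a::field) ratfun ^ 'y ^ 'u \<Rightarrow> 'a ratfun ^ 'b ^ 'u \<Rightarrow>
   'a ratfun ^ 'y ^ 'b \<Rightarrow> 'a ratfun ^ 'u ^ 'b \<Rightarrow> 'a ratfun ^ 'b ^ 'b \<Rightarrow>
   'a ratfun ^ 'y \<Rightarrow> 'a ratfun ^ 'u \<Rightarrow> 'a ratfun ^ 'b \<Rightarrow> bool"
  where
  "realization Kuy Kub Kby Kbu Kbb y u b \<longleftrightarrow>
     u = Kuy *v y + 0 *v u + Kub *v b \<and>
     b = Kby *v y + Kbu *v u + Kbb *v b"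

text \<open>
  Signals range over vectors of rational functions. As they are universally quantified here and
  \<open>implemented_by\<close> is only used as a hypothesis, admitting more signals (such as
  formal Laurent series in the inverse of \<open>z\<close>) would only make that hypothesis stronger.
\<close>

definition implemented_by ::
  "('a::field) ratfun ^ 'y ^ 'u \<Rightarrow>
   'a ratfun ^ 'y ^ 'u \<Rightarrow> 'a ratfun ^ 'b ^ 'u \<Rightarrow>
   'a ratfun ^ 'y ^ 'b \<Rightarrow> 'a ratfun ^ 'u ^ 'b \<Rightarrow> 'a ratfun ^ 'b ^ 'b \<Rightarrow> bool"
  where
  "implemented_by K Kuy Kub Kby Kbu Kbb \<longleftrightarrow>
     (\<forall>y u b. realization Kuy Kub Kby Kbu Kbb y u b \<longrightarrow> u = K *v y)"

end

theory Submission
  imports Defs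
begin

text \<open>
  For every input \<open>y\<close> the two block rows can be solved explicitly: with
  \<open>u = (1 - Q Kbu)\<inverse> (Kuy + Q Kby) y\<close> and \<open>b = (1 - Kbb)\<inverse> (Kby y + Kbu u)\<close> the triple
  \<open>(y, u, b)\<close> satisfies the realization. Hence \<open>K y = u\<close> for every \<open>y\<close>, which determines \<open>K\<close>.
\<close>

text \<open>\<open>matrix_inv\<close> is a Hilbert choice; invertibility makes the chosen matrix a
  genuine inverse.\<close>

lemma matrix_inv_mul_vector_cancel:
  fixes A :: "'a::semiring_1 ^ 'n ^ 'm"
  assumes "invertible A"
  shows "A *v (matrix_inv A *v x) = x"
proof -
  have "A ** matrix_inv A = mat 1"
    using assms unfolding invertible_def matrix_inv_def
    by (rule someI2_ex) blast
  then show ?thesis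
    by (simp add: matrix_vector_mul_assoc)
qed

lemma realization_solution:
  fixes Kuy :: "('a::field) ratfun ^ 'y ^ 'u"
    and Kub Q :: "'a ratfun ^ 'b ^ 'u"
    and Kby :: "'a ratfun ^ 'y ^ 'b"
    and Kbu :: "'a ratfun ^ 'u ^ 'b"
    and Kbb :: "'a ratfun ^ 'b ^ 'b"
  assumes Kbb: "invertible (mat 1 - Kbb)"
    and Q: "Q = Kub ** matrix_inv (mat 1 - Kbb)"
    and QKbu: "invertible (mat 1 - Q ** Kbu)"
    and u: "u = (matrix_inv (mat 1 - Q ** Kbu) ** (Kuy + Q ** Kby)) *v y"
    and b: "b = matrix_inv (mat 1 - Kbb) *v (Kby *v y + Kbu *v u)"
  shows "realization Kuy Kub Kby Kbu Kbb y u b"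
proof -
  have "(mat 1 - Q ** Kbu) *v u = (Kuy + Q ** Kby) *v y"
    unfolding u by (simp add: matrix_inv_mul_vector_cancel[OF QKbu] flip: matrix_vector_mul_assoc)
  \<comment> \<open>Moving the \<open>Q ** Kbu\<close> term to the right exposes the vector to which
    \<open>Q\<close> and, in \<open>b\<close>, the inverse of \<open>mat 1 - Kbb\<close> are
    applied.\<close>
  then have "u = Kuy *v y + Q *v (Kby *v y + Kbu *v u)"
    by (simp add: matrix_vector_mult_diff_rdistrib matrix_vector_mult_add_rdistrib
        matrix_vector_right_distrib matrix_vector_mul_assoc algebra_simps)
  also have "Q *v (Kby *v y + Kbu *v u) = Kub *v b"
    by (simp add: Q b matrix_vector_mul_assoc)
  finally have "u = Kuy *v y + Kub *v b" .
  moreover have "(mat 1 - Kbb) *v b = Kby *v y + Kbu *v u"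
    unfolding b by (rule matrix_inv_mul_vector_cancel[OF Kbb])
  then have "b = Kby *v y + Kbu *v u + Kbb *v b"
    by (simp add: matrix_vector_mult_diff_rdistrib algebra_simps)
  ultimately show ?thesis
    by (simp add: realization_def)
qed

theorem theorem2:
  fixes K Kuy :: "('a::field) ratfun ^ 'y ^ 'u"
    and Kub Q :: "'a ratfun ^ 'b ^ 'u"
    and Kby :: "'a ratfun ^ 'y ^ 'b"
    and Kbu :: "'a ratfun ^ 'u ^ 'b"
    and Kbb :: "'a ratfun ^ 'b ^ 'b"
  assumes "invertible (mat 1 - Kbb)"
    and "Q = Kub ** matrix_inv (mat 1 - Kbb)"
    and "invertible (mat 1 - Q ** Kbu)"
    and "implemented_by K Kuy Kub Kby Kbu Kbb"
  shows "K = matrix_inv (mat 1 - Q ** Kbu) ** (Kuy + Q ** Kby)"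
  \<comment> \<open>Matrices are compared on every vector \<open>y\<close>; the two
    \<open>refl\<close> fix \<open>u\<close> and \<open>b\<close> as the explicit solution, so
    \<open>implemented_by\<close> forces \<open>K *v y\<close> to be that \<open>u\<close>.\<close>
  unfolding matrix_eq
  using realization_solution[OF assms(1-3) refl refl] assms(4)
  unfolding implemented_by_def by metis

end
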